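(* Let $E$ be a separable Banach space, $I$ a good rate function on $E$ and $H=\{I<\infty\}$ its effective set, satisfying the standing assumptions in the context. Let $F_n:H\to E$ $(n=1,2,\ldots)$ be a sequence of rate-function mappings, and suppose that $F_n$ converges to a mapping $F:H\to E$ uniformly (in the norm of $E$) on every level set $K_L=\{s:I(s)\le L\}$. For each $n$, let $\{X_n^{\varepsilon}:\varepsilon\in(0,1)\}$, as well as $\{X^{\varepsilon}:\varepsilon\in(0,1)\}$, be a family of $E$-valued random variables on a complete probability space $(\Omega,\mathcal{F},P)$. Suppose that: 1) for every $\delta>0$, $$\lim_{n\to\infty}\limsup_{\varepsilon\downarrow0}\varepsilon\log P\{\rho(X_n^{\varepsilon},X^{\varepsilon})>\delta\}=-\infty;$$ 2) for each $n$, (the family of distributions of) $\{X_n^{\varepsilon}:\varepsilon\in(0,1)\}$ satisfies the large deviation principle with rate function $I_{F_n}$. Then the family $\{\mu_\varepsilon:\varepsilon\in(0,1)\}$ of distributions of $\{X^{\varepsilon}:\varepsilon\in(0,1)\}$ satisfies the large deviation principle with rate function $I_F$.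
   Context: $E$ is a separable Banach space with norm $\|\cdot\|$ and distance $\rho(s,s')=\|s-s'\|$. $I:E\to[0,\infty]$ is a good rate function, i.e. each level set $K_L=\{s\in E:I(s)\le L\}$, $L\ge0$, is compact in $E$. Let $H=\{s:I(s)<\infty\}$. Standing assumptions: (i) $H$ is a dense vector subspace of $E$ carrying a norm $\|\cdot\|_H$ for which $(H,\|\cdot\|_H)$ is a Hilbert space; (ii) for each $L\ge0$, $K_L$ is weakly compact, bounded and closed in $(H,\|\cdot\|_H)$; and there is a constant $C$ with $\|s\|\le C\|s\|_H$ for all $s\in H$. A mapping $G:H\to E$ is a rate-function mapping if: 1) $G$ is continuous from $(H,\|\cdot\|_H)$ to $(E,\|\cdot\|)$; 2) $G$ is weakly continuous on every $K_L$: if $s_k\in K_L$ and $s_k\to s$ weakly in $H$ (so that $s\in K_L$), then $G(s_k)\to G(s)$ weakly in $E$; 3) for every $L\ge0$, $G(K_L)$ is compact in $(E,\|\cdot\|)$. For $G:H\to E$, $I_G(s')=\inf\{I(s):s\in H,\ G(s)=s'\}$ for $s'\in E$, with $\inf\emptyset=\infty$. A family $\{\mu_\varepsilon\}$ of Borel probability measures on $E$ satisfies the large deviation principle with rate function $J$ if $\limsup_{\varepsilon\downarrow0}\varepsilon\log\mu_\varepsilon(S)\le-\inf_{S}J$ for every closed $S\subset E$ and $\liminf_{\varepsilon\downarrow0}\varepsilon\log\mu_\varepsilon(O)\ge-\inf_{O}J$ for every open $O\subset E$. *)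

theory Defs
  imports "HOL-Probability.Probability"
begin

definition level_set :: "('e \<Rightarrow> ennreal) \<Rightarrow> real \<Rightarrow> 'e set" where
  "level_set I L = {s. I s \<le> ennreal L}"

definition effective_set :: "('e \<Rightarrow> ennreal) \<Rightarrow> 'e set" where
  "effective_set I = {s. I s < \<infinity>}"

definition good_rate_function :: "('e::topological_space \<Rightarrow> ennreal) \<Rightarrow> bool" where
  "good_rate_function I \<longleftrightarrow> (\<forall>L\<ge>0. compact (level_set I L))"

text \<open>The infimum of the empty set is \<^term>\<open>\<infinity> :: ennreal\<close>. Values of \<open>G\<close> outside the effective
  set are irrelevant.\<close>

definition image_rate :: "('e \<Rightarrow> ennreal) \<Rightarrow> ('e \<Rightarrow> 'e) \<Rightarrow> 'e \<Rightarrow> ennreal" where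
  "image_rate I G s' = (INF s\<in>{s \<in> effective_set I. G s = s'}. I s)"

text \<open>A subspace \<open>V\<close> may carry a norm \<open>N\<close> different from that of the surrounding space, so \<open>N\<close>
  is a function that is only meaningful on \<open>V\<close>. The cut-off outside \<open>V\<close> makes the distance
  satisfy the axioms of \<^locale>\<open>Metric_space\<close>, some of which are not relativised to the carrier.\<close>

definition norm_dist :: "'a::real_vector set \<Rightarrow> ('a \<Rightarrow> real) \<Rightarrow> 'a \<Rightarrow> 'a \<Rightarrow> real" where
  "norm_dist V N x y = (if x \<in> V \<and> y \<in> V then N (x - y) else 0)"

definition norm_topology :: "'a::real_vector set \<Rightarrow> ('a \<Rightarrow> real) \<Rightarrow> 'a topology" where
  "norm_topology V N = Metric_space.mtopology V (norm_dist V N)"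

definition inner_product_on :: "'a::real_vector set \<Rightarrow> ('a \<Rightarrow> 'a \<Rightarrow> real) \<Rightarrow> bool" where
  "inner_product_on V ip \<longleftrightarrow>
     (\<forall>x\<in>V. \<forall>y\<in>V. ip x y = ip y x) \<and>
     (\<forall>x\<in>V. \<forall>y\<in>V. \<forall>z\<in>V. ip (x + y) z = ip x z + ip y z) \<and>
     (\<forall>c. \<forall>x\<in>V. \<forall>y\<in>V. ip (c *\<^sub>R x) y = c * ip x y) \<and>
     (\<forall>x\<in>V. x \<noteq> 0 \<longrightarrow> ip x x > 0)"

definition hilbert_space_on :: "'a::real_vector set \<Rightarrow> ('a \<Rightarrow> real) \<Rightarrow> bool" where
  "hilbert_space_on V N \<longleftrightarrow>
     subspace V \<and>
     (\<exists>ip. inner_product_on V ip \<and> (\<forall>x\<in>V. N x = sqrt (ip x x))) \<and>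
     Metric_space.mcomplete V (norm_dist V N)"

definition dual_on :: "'a::real_vector set \<Rightarrow> ('a \<Rightarrow> real) \<Rightarrow> ('a \<Rightarrow> real) set" where
  "dual_on V N = {\<phi>.
     (\<forall>x\<in>V. \<forall>y\<in>V. \<phi> (x + y) = \<phi> x + \<phi> y) \<and>
     (\<forall>c. \<forall>x\<in>V. \<phi> (c *\<^sub>R x) = c * \<phi> x) \<and>
     (\<exists>B. \<forall>x\<in>V. \<bar>\<phi> x\<bar> \<le> B * N x)}"

text \<open>The coarsest topology on \<open>V\<close> making all functionals of the dual continuous. The weak topology
  of the whole space is \<open>weak_topology UNIV norm\<close>.\<close>

definition weak_topology :: "'a::real_vector set \<Rightarrow> ('a \<Rightarrow> real) \<Rightarrow> 'a topology" where
  "weak_topology V N = topology_generated_by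
     {{x \<in> V. \<phi> x \<in> U} | \<phi> U. \<phi> \<in> dual_on V N \<and> open U}"

text \<open>\<open>N\<close> is the Hilbert norm on the effective set of \<open>I\<close>.\<close>

definition rate_function_mapping ::
    "('e::real_normed_vector \<Rightarrow> ennreal) \<Rightarrow> ('e \<Rightarrow> real) \<Rightarrow> ('e \<Rightarrow> 'e) \<Rightarrow> bool" where
  "rate_function_mapping I N G \<longleftrightarrow>
     continuous_map (norm_topology (effective_set I) N) euclidean G \<and>
     (\<forall>L\<ge>0. \<forall>\<sigma> s. (\<forall>k. \<sigma> k \<in> level_set I L) \<and>
         limitin (weak_topology (effective_set I) N) \<sigma> s sequentially \<longrightarrow>
         limitin (weak_topology UNIV norm) (\<lambda>k. G (\<sigma> k)) (G s) sequentially) \<and>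
     (\<forall>L\<ge>0. compact (G ` level_set I L))"

text \<open>The logarithm with \<open>log 0 = -\<infinity>\<close>; the library's \<^term>\<open>ln (0::real)\<close> is \<open>0\<close>.\<close>

definition ext_ln :: "real \<Rightarrow> ereal" where
  "ext_ln p = (if p = 0 then -\<infinity> else ereal (ln p))"

text \<open>Only the measures \<open>\<mu> \<epsilon>\<close> with \<open>0 < \<epsilon> < 1\<close> matter, as the limits are taken along
  \<open>at_right 0\<close>.\<close>

definition large_deviation_principle ::
    "(real \<Rightarrow> 'e::topological_space measure) \<Rightarrow> ('e \<Rightarrow> ennreal) \<Rightarrow> bool" where
  "large_deviation_principle \<mu> J \<longleftrightarrow>
     (\<forall>S. closed S \<longrightarrow>
        Limsup (at_right 0) (\<lambda>\<epsilon>. ereal \<epsilon> * ext_ln (measure (\<mu> \<epsilon>) S))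
          \<le> - enn2ereal (INF s\<in>S. J s)) \<and>
     (\<forall>U. open U \<longrightarrow>
        Liminf (at_right 0) (\<lambda>\<epsilon>. ereal \<epsilon> * ext_ln (measure (\<mu> \<epsilon>) U))
          \<ge> - enn2ereal (INF s\<in>U. J s))"

end

theory Submission
  imports Defs
begin

text \<open>Each level set \<open>K\<^sub>L\<close> is compact both in norm and in the weak topology of \<open>H\<close>. Both are finer
  than the weak topology of \<open>E\<close>, which is Hausdorff by the Hahn--Banach theorem, so all three
  coincide on \<open>K\<^sub>L\<close>; likewise norm and weak topology coincide on the compact set \<open>F\<^sub>n(K\<^sub>L)\<close>. Hence
  weak continuity makes \<open>F\<^sub>n\<close> norm continuous on \<open>K\<^sub>L\<close>, the uniform limit \<open>F\<close> inherits this, and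
  \<open>F(K\<^sub>L)\<close> is compact. A closed set \<open>S\<close> with \<open>inf\<^sub>S I\<^sub>F > L\<close> therefore has positive distance from
  \<open>F(K\<^sub>L)\<close>, so the upper bound for \<open>X\<close> on \<open>S\<close> follows from the one for \<open>X\<^sub>n\<close> on the complement of a
  neighbourhood of \<open>F(K\<^sub>L)\<close>; the lower bound at \<open>F(s)\<close> follows from the one for \<open>X\<^sub>n\<close> on a small
  ball around \<open>F(s)\<close>, which contains \<open>F\<^sub>n(s)\<close>.\<close>

subsection \<open>Hahn--Banach\<close>

text \<open>Only one inequality at strictly positive scalars is demanded, so that the property is
  quick to verify for infima; equality at all nonnegative scalars is derived below.\<close>

definition sublinear :: "('a::real_vector \<Rightarrow> real) \<Rightarrow> bool" where
  "sublinear p \<longleftrightarrow> (\<forall>x y. p (x + y) \<le> p x + p y) \<and> (\<forall>c>0. \<forall>x. p (c *\<^sub>R x) \<le> c * p x)"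

lemma sublinear_add: "sublinear p \<Longrightarrow> p (x + y) \<le> p x + p y"
  by (simp add: sublinear_def)

lemma sublinear_scaleR_le: "sublinear p \<Longrightarrow> c > 0 \<Longrightarrow> p (c *\<^sub>R x) \<le> c * p x"
  by (simp add: sublinear_def)

lemma sublinear_zero:
  assumes "sublinear p"
  shows "p 0 = 0"
  using sublinear_add[OF assms, of 0 0] sublinear_scaleR_le[OF assms, of "1/2" 0] by simp

text \<open>For \<open>c > 0\<close> the reverse inequality is the assumed one with
  \<open>1/c\<close> at the point \<open>c *\<^sub>R x\<close>.\<close>

lemma sublinear_scaleR:
  assumes "sublinear p" "c \<ge> 0"
  shows "p (c *\<^sub>R x) = c * p x"
proof (cases "c = 0")
  case True
  then show ?thesis using sublinear_zero[OF assms(1)] by simp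
next
  case False
  with assms have c: "c > 0" by simp
  have "p x \<le> (1/c) * p (c *\<^sub>R x)"
    using sublinear_scaleR_le[OF assms(1), of "1/c" "c *\<^sub>R x"] c by simp
  with c have "c * p x \<le> p (c *\<^sub>R x)" by (simp add: field_simps)
  with sublinear_scaleR_le[OF assms(1) c, of x] show ?thesis by simp
qed

lemma sublinear_ge_uminus:
  assumes "sublinear p"
  shows "- p (- x) \<le> p x"
  using sublinear_add[OF assms, of x "- x"] sublinear_zero[OF assms] by simp

text \<open>This is the largest sublinear functional below \<open>p\<close> whose value at
  \<open>- y\<close> is at most \<open>- p y\<close>. Tilting thus pushes \<open>p\<close> towards
  oddness in the direction \<open>y\<close>.\<close>

definition tilt :: "('a::real_vector \<Rightarrow> real) \<Rightarrow> 'a \<Rightarrow> 'a \<Rightarrow> real" where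
  "tilt p y x = (INF t\<in>{0..}. p (x + t *\<^sub>R y) - t * p y)"

text \<open>Subadditivity bounds all the competing values from below by \<open>- p (- x)\<close>, so
  the real infimum is a genuine one.\<close>

lemma tilt_le:
  assumes "sublinear p" "t \<ge> 0"
  shows "tilt p y x \<le> p (x + t *\<^sub>R y) - t * p y"
proof -
  have "- p (- x) \<le> p (x + s *\<^sub>R y) - s * p y" if "s \<ge> 0" for s
    using sublinear_add[OF assms(1), of "x + s *\<^sub>R y" "- x"] sublinear_scaleR[OF assms(1) that, of y]
    by simp
  then have "bdd_below ((\<lambda>t. p (x + t *\<^sub>R y) - t * p y) ` {0..})"
    by (intro bdd_belowI2[where m = "- p (- x)"]) auto
  then show ?thesis
    unfolding tilt_def using assms(2) by (intro cINF_lower) auto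
qed

lemma tilt_greatest:
  assumes "\<And>t. t \<ge> 0 \<Longrightarrow> b \<le> p (x + t *\<^sub>R y) - t * p y"
  shows "b \<le> tilt p y x"
  unfolding tilt_def using assms by (intro cINF_greatest) auto

text \<open>Parameters \<open>t\<close> for \<open>x\<close> and \<open>u\<close> for
  \<open>z\<close> combine to the parameter \<open>t + u\<close> for \<open>x + z\<close>; the
  parameter \<open>t\<close> for \<open>x\<close> corresponds to \<open>c * t\<close> for
  \<open>c *\<^sub>R x\<close>.\<close>

lemma sublinear_tilt:
  assumes p: "sublinear p"
  shows "sublinear (tilt p y)"
  unfolding sublinear_def
proof (intro conjI allI impI)
  fix x z
  have "tilt p y (x + z) - (p (z + u *\<^sub>R y) - u * p y) \<le> p (x + t *\<^sub>R y) - t * p y"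
    if "t \<ge> 0" "u \<ge> 0" for t u
  proof -
    have "tilt p y (x + z) \<le> p (x + z + (t + u) *\<^sub>R y) - (t + u) * p y"
      using that by (intro tilt_le[OF p]) auto
    also have "x + z + (t + u) *\<^sub>R y = (x + t *\<^sub>R y) + (z + u *\<^sub>R y)"
      by (simp add: algebra_simps)
    finally show ?thesis
      using sublinear_add[OF p, of "x + t *\<^sub>R y" "z + u *\<^sub>R y"] by (simp add: algebra_simps)
  qed
  then have "tilt p y (x + z) - (p (z + u *\<^sub>R y) - u * p y) \<le> tilt p y x" if "u \<ge> 0" for u
    using that by (intro tilt_greatest)
  then have "tilt p y (x + z) - tilt p y x \<le> p (z + u *\<^sub>R y) - u * p y" if "u \<ge> 0" for u
    using that by (simp add: algebra_simps)
  then have "tilt p y (x + z) - tilt p y x \<le> tilt p y z"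
    by (intro tilt_greatest)
  then show "tilt p y (x + z) \<le> tilt p y x + tilt p y z" by simp
next
  fix c :: real and x
  assume c: "c > 0"
  have "tilt p y (c *\<^sub>R x) / c \<le> p (x + t *\<^sub>R y) - t * p y" if "t \<ge> 0" for t
  proof -
    have "tilt p y (c *\<^sub>R x) \<le> p (c *\<^sub>R x + (c * t) *\<^sub>R y) - (c * t) * p y"
      using that c by (intro tilt_le[OF p]) auto
    also have "c *\<^sub>R x + (c * t) *\<^sub>R y = c *\<^sub>R (x + t *\<^sub>R y)"
      by (simp add: algebra_simps)
    finally have "tilt p y (c *\<^sub>R x) \<le> c * (p (x + t *\<^sub>R y) - t * p y)"
      using sublinear_scaleR[OF p, of c "x + t *\<^sub>R y"] c by (simp add: algebra_simps)
    with c show ?thesis by (simp add: field_simps)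
  qed
  then have "tilt p y (c *\<^sub>R x) / c \<le> tilt p y x" by (intro tilt_greatest)
  with c show "tilt p y (c *\<^sub>R x) \<le> c * tilt p y x" by (simp add: field_simps)
qed

lemma tilt_le_self: "sublinear p \<Longrightarrow> tilt p y x \<le> p x"
  using tilt_le[of p 0 y x] by simp

lemma tilt_uminus_le: "sublinear p \<Longrightarrow> tilt p y (- y) \<le> - p y"
  using tilt_le[of p 1 y "- y"] sublinear_zero[of p] by simp

text \<open>This provides the lower bounds of chains for Zorn's lemma. All members lie above
  \<open>- g (- x)\<close> at \<open>x\<close>, so the pointwise infimum is finite.\<close>

lemma sublinear_chain_Inf:
  assumes C: "C \<noteq> {}" and sub: "\<And>p. p \<in> C \<Longrightarrow> sublinear p"
    and bound: "\<And>p. p \<in> C \<Longrightarrow> p \<le> g"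
    and chain: "\<And>p q. p \<in> C \<Longrightarrow> q \<in> C \<Longrightarrow> p \<le> q \<or> q \<le> p"
  shows "sublinear (\<lambda>x. INF p\<in>C. p x)" and "\<And>p x. p \<in> C \<Longrightarrow> (INF p\<in>C. p x) \<le> p x"
proof -
  have "- g (- x) \<le> p x" if "p \<in> C" for p x
    using le_funD[OF bound[OF that], of "- x"] sublinear_ge_uminus[OF sub[OF that], of x] by linarith
  then have "bdd_below ((\<lambda>p. p x) ` C)" for x
    by (intro bdd_belowI2[where m = "- g (- x)"]) auto
  then show lower: "(INF p\<in>C. p x) \<le> p x" if "p \<in> C" for p x
    using that by (intro cINF_lower) auto
  show "sublinear (\<lambda>x. INF p\<in>C. p x)"
    unfolding sublinear_def
  proof (intro conjI allI impI)
    fix x y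
    have "(INF p\<in>C. p (x + y)) - q y \<le> p x" if pq: "p \<in> C" "q \<in> C" for p q
    proof -
      \<comment> \<open>The infima at \<open>x\<close> and at \<open>y\<close> may be approached by
        different members; the smaller of the two serves at both points.\<close>
      obtain r where r: "r \<in> C" "r \<le> p" "r \<le> q" using chain[OF pq] pq by blast
      have "(INF p\<in>C. p (x + y)) \<le> r x + r y"
        using lower[OF r(1), of "x + y"] sublinear_add[OF sub[OF r(1)], of x y] by linarith
      with le_funD[OF r(2), of x] le_funD[OF r(3), of y] show ?thesis by linarith
    qed
    then have "(INF p\<in>C. p (x + y)) - q y \<le> (INF p\<in>C. p x)" if "q \<in> C" for q
      using that C by (intro cINF_greatest)
    then have "(INF p\<in>C. p (x + y)) - (INF p\<in>C. p x) \<le> q y" if "q \<in> C" for q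
      using that by (simp add: algebra_simps)
    then have "(INF p\<in>C. p (x + y)) - (INF p\<in>C. p x) \<le> (INF p\<in>C. p y)"
      using C by (intro cINF_greatest)
    then show "(INF p\<in>C. p (x + y)) \<le> (INF p\<in>C. p x) + (INF p\<in>C. p y)" by simp
  next
    fix c :: real and x
    assume c: "c > 0"
    have "(INF p\<in>C. p (c *\<^sub>R x)) / c \<le> p x" if "p \<in> C" for p
      using lower[OF that, of "c *\<^sub>R x"] sublinear_scaleR_le[OF sub[OF that] c, of x] c
      by (simp add: field_simps)
    then have "(INF p\<in>C. p (c *\<^sub>R x)) / c \<le> (INF p\<in>C. p x)"
      using C by (intro cINF_greatest)
    with c show "(INF p\<in>C. p (c *\<^sub>R x)) \<le> c * (INF p\<in>C. p x)" by (simp add: field_simps)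
  qed
qed

text \<open>A pointwise minimal sublinear functional coincides with all its tilts, hence is odd.\<close>

lemma sublinear_dominates_linear:
  assumes g: "sublinear g"
  obtains \<phi> where "linear \<phi>" "\<And>x. \<phi> x \<le> g x"
proof -
  define A where "A = {p. sublinear p \<and> p \<le> g}"
  \<comment> \<open>Zorn's lemma for the reversed order yields a minimal element; the empty chain is
    bounded by \<open>g\<close> itself.\<close>
  have "\<exists>m\<in>A. \<forall>a\<in>A. m \<ge> a \<longrightarrow> a = m"
  proof (rule predicate_Zorn)
    show "partial_order_on A (relation_of (\<ge>) A)"
      by (rule partial_order_on_relation_ofI) auto
  next
    fix C assume C: "C \<in> Chains (relation_of (\<ge>) A)"
    then have CA: "C \<subseteq> A" by (rule Chains_relation_of)
    show "\<exists>u\<in>A. \<forall>a\<in>C. a \<ge> u"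
    proof (cases "C = {}")
      case True
      then show ?thesis using g by (auto simp: A_def)
    next
      case False
      have 1: "sublinear p" if "p \<in> C" for p using that CA by (auto simp: A_def)
      have 2: "p \<le> g" if "p \<in> C" for p using that CA by (auto simp: A_def)
      have 3: "p \<le> q \<or> q \<le> p" if "p \<in> C" "q \<in> C" for p q
        using that C by (auto simp: Chains_def relation_of_def)
      have inf: "sublinear (\<lambda>x. INF p\<in>C. p x)" by (rule sublinear_chain_Inf(1)[OF False]) (use 1 2 3 in auto)
      have lower: "(INF p\<in>C. p x) \<le> p x" if "p \<in> C" for p x
        by (rule sublinear_chain_Inf(2)[OF False]) (use 1 2 3 that in auto)
      obtain p where p: "p \<in> C" using False by blast
      have "(\<lambda>x. INF p\<in>C. p x) \<le> g"
        using lower[OF p] le_funD[OF 2[OF p]] by (meson le_funI order_trans)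
      with inf lower show ?thesis
        by (intro bexI[of _ "\<lambda>x. INF p\<in>C. p x"]) (auto simp: A_def le_fun_def)
    qed
  qed
  then obtain m where m: "sublinear m" "m \<le> g" and min: "\<And>a. a \<in> A \<Longrightarrow> a \<le> m \<Longrightarrow> a = m"
    by (auto simp: A_def)
  have "tilt m y = m" for y
  proof (rule min)
    show "tilt m y \<le> m" by (simp add: le_fun_def tilt_le_self[OF m(1)])
    with m(2) show "tilt m y \<in> A" using sublinear_tilt[OF m(1), of y] by (simp add: A_def)
  qed
  then have "m (- y) \<le> - m y" for y
    using tilt_uminus_le[OF m(1), of y] by simp
  then have odd: "m (- y) = - m y" for y
    using sublinear_ge_uminus[OF m(1), of y] by (smt (verit))
  have "linear m"
  proof (rule linearI)
    show "m (x + y) = m x + m y" for x y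
      \<comment> \<open>The second instance reads \<open>m x \<le> m (x + y) - m y\<close> by
        oddness, which is the missing inequality.\<close>
      using sublinear_add[OF m(1), of x y] sublinear_add[OF m(1), of "x + y" "- y"] odd[of y] by simp
    show "m (c *\<^sub>R x) = c *\<^sub>R m x" for c x
    proof (cases "c \<ge> 0")
      case True
      then show ?thesis using sublinear_scaleR[OF m(1)] by simp
    next
      case False
      then have "m (- ((- c) *\<^sub>R x)) = c * m x"
        using sublinear_scaleR[OF m(1), of "- c" x] odd[of "(- c) *\<^sub>R x"] by simp
      then show ?thesis by simp
    qed
  qed
  with m(2) that show thesis by (auto simp: le_fun_def)
qed

text \<open>A linear functional below the tilt of the norm at \<open>y\<close>, rather than below
  the norm alone, has value at most \<open>- norm y\<close> at \<open>- y\<close>, and so it attains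
  the norm at \<open>y\<close>.\<close>

lemma norming_functional:
  fixes y :: "'a::real_normed_vector"
  obtains \<phi> where "linear \<phi>" "\<And>x. \<bar>\<phi> x\<bar> \<le> norm x" "\<phi> y = norm y"
proof -
  have norm: "sublinear (norm :: 'a \<Rightarrow> real)"
    by (auto simp: sublinear_def norm_triangle_ineq)
  obtain \<phi> where \<phi>: "linear \<phi>" "\<And>x. \<phi> x \<le> tilt norm y x"
    using sublinear_dominates_linear[OF sublinear_tilt[OF norm]] by blast
  have le: "\<phi> x \<le> norm x" for x
    using \<phi>(2)[of x] tilt_le_self[OF norm, of y x] by linarith
  have neg: "\<phi> (- x) = - \<phi> x" for x using linear_neg[OF \<phi>(1)] by simp
  have "\<bar>\<phi> x\<bar> \<le> norm x" for x
    using le[of x] le[of "- x"] neg[of x] by simp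
  moreover have "\<phi> y = norm y"
    using \<phi>(2)[of "- y"] tilt_uminus_le[OF norm, of y] neg[of y] le[of y] by linarith
  ultimately show thesis using \<phi>(1) that by blast
qed

subsection \<open>Weak topologies\<close>

lemma zero_in_dual_on: "(\<lambda>_. 0) \<in> dual_on V N"
  by (auto simp: dual_on_def intro!: exI[of _ 0])

lemma topspace_weak_topology [simp]: "topspace (weak_topology V N) = V"
proof -
  \<comment> \<open>The zero functional with the open set \<open>UNIV\<close> makes \<open>V\<close>
    itself a generator.\<close>
  have "V \<in> {{x \<in> V. \<phi> x \<in> U} | \<phi> U. \<phi> \<in> dual_on V N \<and> open (U :: real set)}"
    using zero_in_dual_on[of V N] by (auto intro!: exI[of _ "\<lambda>_. 0"] exI[of _ UNIV])
  then show ?thesis unfolding weak_topology_def topology_generated_by_topspace by auto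
qed

lemma openin_weak_topology:
  "\<phi> \<in> dual_on V N \<Longrightarrow> open U \<Longrightarrow> openin (weak_topology V N) {x \<in> V. \<phi> x \<in> U}"
  unfolding weak_topology_def by (rule topology_generated_by_Basis) auto

lemma continuous_map_into_weak_topology:
  assumes "f \<in> topspace T \<rightarrow> V"
    and "\<And>\<phi> U. \<phi> \<in> dual_on V N \<Longrightarrow> open U \<Longrightarrow> openin T {x \<in> topspace T. \<phi> (f x) \<in> U}"
  shows "continuous_map T (weak_topology V N) f"
  unfolding weak_topology_def
proof (rule continuous_on_generated_topo)
  fix U assume "U \<in> {{x \<in> V. \<phi> x \<in> U} | \<phi> U. \<phi> \<in> dual_on V N \<and> open U}"
  then obtain \<phi> W where *: "U = {x \<in> V. \<phi> x \<in> W}" "\<phi> \<in> dual_on V N" "open W" by blast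
  have "f -` U \<inter> topspace T = {x \<in> topspace T. \<phi> (f x) \<in> W}"
    using assms(1) * by auto
  then show "openin T (f -` U \<inter> topspace T)" using assms(2) * by simp
next
  show "f ` topspace T \<subseteq> \<Union> {{x \<in> V. \<phi> x \<in> U} | \<phi> U. \<phi> \<in> dual_on V N \<and> open U}"
    using assms(1) topspace_weak_topology[of V N]
    unfolding weak_topology_def topology_generated_by_topspace by auto
qed

lemma dual_on_UNIV_norm:
  "\<phi> \<in> dual_on UNIV norm \<longleftrightarrow> bounded_linear (\<phi> :: 'a::real_normed_vector \<Rightarrow> real)"
proof
  assume "\<phi> \<in> dual_on UNIV norm"
  then obtain B where "\<And>x y. \<phi> (x + y) = \<phi> x + \<phi> y" "\<And>c x. \<phi> (c *\<^sub>R x) = c * \<phi> x"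
      "\<And>x. \<bar>\<phi> x\<bar> \<le> B * norm x"
    unfolding dual_on_def by auto
  then show "bounded_linear \<phi>"
    by (intro bounded_linear_intro[where K = B]) (auto simp: mult.commute)
next
  assume "bounded_linear \<phi>"
  then interpret bounded_linear \<phi> .
  from bounded obtain K where "\<And>x. \<bar>\<phi> x\<bar> \<le> norm x * K" by auto
  then show "\<phi> \<in> dual_on UNIV norm"
    by (auto simp: dual_on_def add scaleR mult.commute)
qed

lemma continuous_map_weak_topology_id:
  "continuous_map euclidean (weak_topology UNIV norm) (\<lambda>x::'a::real_normed_vector. x)"
proof (rule continuous_map_into_weak_topology)
  fix \<phi> :: "'a \<Rightarrow> real" and U :: "real set"
  assume *: "\<phi> \<in> dual_on UNIV norm" "open U"
  then have "continuous_on UNIV \<phi>"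
    using dual_on_UNIV_norm linear_continuous_on by blast
  with *(2) have "open (\<phi> -` U)" by (simp add: open_vimage)
  then show "openin euclidean {x \<in> topspace euclidean. \<phi> x \<in> U}"
    by (simp add: vimage_def)
qed auto

text \<open>A norming functional of \<open>x - y\<close> takes different values at \<open>x\<close>
  and \<open>y\<close>; preimages of disjoint open sets of reals then separate the points.\<close>

lemma Hausdorff_weak_topology:
  "Hausdorff_space (weak_topology UNIV (norm :: 'a::real_normed_vector \<Rightarrow> real))"
  unfolding Hausdorff_space_def
proof (intro allI impI)
  fix x y :: 'a
  assume "x \<in> topspace (weak_topology UNIV norm) \<and> y \<in> topspace (weak_topology UNIV norm) \<and> x \<noteq> y"
  then have xy: "x \<noteq> y" by simp
  obtain \<phi> where \<phi>: "linear \<phi>" "\<And>z. \<bar>\<phi> z\<bar> \<le> norm z" "\<phi> (x - y) = norm (x - y)"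
    using norming_functional by blast
  have "bounded_linear \<phi>"
    using \<phi>(1,2) by (intro bounded_linear_intro[where K = 1]) (auto simp: linear_add linear_cmul)
  then have dual: "\<phi> \<in> dual_on UNIV norm" by (simp add: dual_on_UNIV_norm)
  have "\<phi> x \<noteq> \<phi> y"
    using \<phi> xy linear_diff[OF \<phi>(1), of x y] by auto
  then obtain U V where UV: "open U" "open V" "\<phi> x \<in> U" "\<phi> y \<in> V" "U \<inter> V = {}"
    using hausdorff by meson
  then show "\<exists>U V. openin (weak_topology UNIV norm) U \<and> openin (weak_topology UNIV norm) V
      \<and> x \<in> U \<and> y \<in> V \<and> disjnt U V"
    using openin_weak_topology[OF dual UV(1)] openin_weak_topology[OF dual UV(2)] UV(3-5)
    by (intro exI[of _ "{z \<in> UNIV. \<phi> z \<in> U}"] exI[of _ "{z \<in> UNIV. \<phi> z \<in> V}"] conjI)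
       (auto simp: disjnt_iff)
qed

text \<open>The identity is continuous from the norm to the weak topology, so \<open>K\<close> is
  weakly compact, hence closed in a Hausdorff space.\<close>

lemma compact_imp_closedin_weak_topology:
  fixes K :: "'a::real_normed_vector set"
  assumes "compact K"
  shows "closedin (weak_topology UNIV norm) K"
proof -
  have "compactin (weak_topology UNIV norm) ((\<lambda>x. x) ` K)"
    using assms by (intro image_compactin[OF _ continuous_map_weak_topology_id]) auto
  then show ?thesis
    by (intro compactin_imp_closedin[OF Hausdorff_weak_topology]) auto
qed

text \<open>For a norm neighbourhood \<open>U\<close> of \<open>y\<close>, the set
  \<open>K - U\<close> is norm compact and so weakly closed. Its complement is a weak neighbourhood
  of \<open>y\<close>, and inside \<open>K\<close> it agrees with \<open>U\<close>.\<close>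

lemma weak_limit_in_compact:
  fixes y :: "'a::real_normed_vector"
  assumes K: "compact K" "\<And>k. \<sigma> k \<in> K"
    and lim: "limitin (weak_topology UNIV norm) \<sigma> y sequentially"
  shows "\<sigma> \<longlonglongrightarrow> y"
proof (rule topological_tendstoI)
  fix U assume U: "open U" "y \<in> U"
  have "openin (weak_topology UNIV norm) (- (K - U))"
    using compact_imp_closedin_weak_topology[OF compact_diff[OF K(1) U(1)]]
    by (simp add: closedin_def Compl_eq_Diff_UNIV)
  with lim U(2) have "\<forall>\<^sub>F k in sequentially. \<sigma> k \<in> - (K - U)"
    unfolding limitin_def by blast
  then show "\<forall>\<^sub>F k in sequentially. \<sigma> k \<in> U"
    by eventually_elim (use K(2) in auto)
qed

text \<open>A functional bounded by \<open>K\<close> on the ambient space is bounded by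
  \<open>K * C\<close> with respect to \<open>N\<close> on \<open>V\<close>, so it belongs to the
  dual of \<open>V\<close>.\<close>

lemma weak_topology_subspace_continuous:
  fixes V :: "'a::real_normed_vector set"
  assumes "\<forall>s\<in>V. norm s \<le> C * N s"
  shows "continuous_map (weak_topology V N) (weak_topology UNIV norm) (\<lambda>x. x)"
proof (rule continuous_map_into_weak_topology)
  fix \<phi> :: "'a \<Rightarrow> real" and U :: "real set"
  assume *: "\<phi> \<in> dual_on UNIV norm" "open U"
  then interpret bounded_linear \<phi> by (simp add: dual_on_UNIV_norm)
  obtain K where K: "K > 0" "\<And>x. norm (\<phi> x) \<le> norm x * K" using pos_bounded by blast
  have "\<bar>\<phi> x\<bar> \<le> (K * C) * N x" if "x \<in> V" for x
  proof -
    have "\<bar>\<phi> x\<bar> \<le> norm x * K" using K(2)[of x] by simp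
    also have "\<dots> \<le> (C * N x) * K" using assms that K(1) by (intro mult_right_mono) auto
    finally show ?thesis by (simp add: mult_ac)
  qed
  then have "\<phi> \<in> dual_on V N"
    by (auto simp: dual_on_def add scaleR)
  then show "openin (weak_topology V N) {x \<in> topspace (weak_topology V N). \<phi> x \<in> U}"
    using openin_weak_topology *(2) by simp
qed auto

text \<open>On a weakly compact set, the coarser Hausdorff topology inherited from the weak topology of
  the ambient space is no coarser, so norm limits in the ambient space are weak limits.\<close>

lemma limitin_weak_topology_subspace:
  fixes V :: "'a::real_normed_vector set"
  assumes emb: "\<forall>s\<in>V. norm s \<le> C * N s"
    and K: "compactin (weak_topology V N) K" "\<And>k. \<sigma> k \<in> K" "s \<in> K"
    and lim: "\<sigma> \<longlonglongrightarrow> s"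
  shows "limitin (weak_topology V N) \<sigma> s sequentially"
  unfolding limitin_def
proof (intro conjI allI impI)
  show "s \<in> topspace (weak_topology V N)"
    using K compactin_subset_topspace by blast
next
  fix U assume U: "openin (weak_topology V N) U \<and> s \<in> U"
  have "compactin (weak_topology V N) (K - U)"
  proof -
    have "closedin (weak_topology V N) (topspace (weak_topology V N) - U)"
      using U closedin_topspace by (intro closedin_diff) blast+
    from closed_Int_compactin[OF this K(1)]
    have "compactin (weak_topology V N) ((topspace (weak_topology V N) - U) \<inter> K)" .
    also have "(topspace (weak_topology V N) - U) \<inter> K = K - U"
      using compactin_subset_topspace[OF K(1)] by blast
    finally show ?thesis .
  qed
  \<comment> \<open>The part of \<open>K\<close> outside \<open>U\<close> is moved from the weak
    topology of \<open>V\<close> to the ambient weak topology, where compact sets are closed, and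
    from there to the norm topology.\<close>
  then have "compactin (weak_topology UNIV norm) ((\<lambda>x. x) ` (K - U))"
    by (rule image_compactin[OF _ weak_topology_subspace_continuous[OF emb]])
  then have "closedin (weak_topology UNIV norm) (K - U)"
    by (intro compactin_imp_closedin[OF Hausdorff_weak_topology]) auto
  then have "closed (K - U)"
    using closedin_continuous_map_preimage[OF continuous_map_weak_topology_id] by fastforce
  then have "open (- (K - U))" "s \<in> - (K - U)" using U by (auto simp: open_Compl simp del: Compl_Diff_eq)
  then have "\<forall>\<^sub>F k in sequentially. \<sigma> k \<in> - (K - U)"
    using lim topological_tendstoD by blast
  then show "\<forall>\<^sub>F k in sequentially. \<sigma> k \<in> U"
    by eventually_elim (use K(2) in auto)
qed

text \<open>Norm convergence inside the level set upgrades to weak convergence in \<open>H\<close>,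
  the mapping turns it into weak convergence of the images, and compactness of the image set turns
  this into norm convergence.\<close>

lemma rate_function_mapping_continuous_on:
  fixes I :: "'e::real_normed_vector \<Rightarrow> ennreal"
  assumes emb: "\<forall>s\<in>effective_set I. norm s \<le> C * N s"
    and K: "compactin (weak_topology (effective_set I) N) (level_set I L)" "L \<ge> 0"
    and G: "rate_function_mapping I N G"
  shows "continuous_on (level_set I L) G"
  unfolding continuous_on_sequentially
proof (intro allI ballI impI)
  fix \<sigma> s
  assume s: "s \<in> level_set I L" and \<sigma>: "(\<forall>k. \<sigma> k \<in> level_set I L) \<and> \<sigma> \<longlonglongrightarrow> s"
  then have "limitin (weak_topology (effective_set I) N) \<sigma> s sequentially"
    using limitin_weak_topology_subspace[OF emb K(1)] by blast
  with G K(2) \<sigma> have "limitin (weak_topology UNIV norm) (G \<circ> \<sigma>) (G s) sequentially"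
    unfolding rate_function_mapping_def comp_def by blast
  moreover have "compact (G ` level_set I L)"
    using G K(2) by (auto simp: rate_function_mapping_def)
  ultimately show "(G \<circ> \<sigma>) \<longlonglongrightarrow> G s"
    using \<sigma> by (intro weak_limit_in_compact) auto
qed

subsection \<open>Exponential scale\<close>

text \<open>Bounds on the logarithmic scale become exponential bounds on probabilities, which can be
  added. At \<open>p = 0\<close> the left side is \<open>-\<infinity>\<close> because
  \<open>\<epsilon> > 0\<close>.\<close>

lemma scaled_ext_ln_le_iff:
  assumes "\<epsilon> > 0" "p \<ge> 0"
  shows "ereal \<epsilon> * ext_ln p \<le> ereal M \<longleftrightarrow> p \<le> exp (M / \<epsilon>)"
proof (cases "p = 0")
  case True
  with assms show ?thesis by (simp add: ext_ln_def)
next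
  case False
  with assms have p: "p > 0" by simp
  have "\<epsilon> * ln p \<le> M \<longleftrightarrow> ln p \<le> M / \<epsilon>" using assms(1) by (simp add: field_simps)
  also have "\<dots> \<longleftrightarrow> p \<le> exp (M / \<epsilon>)" using p by (metis exp_le_cancel_iff exp_ln)
  finally show ?thesis using False by (simp add: ext_ln_def)
qed

text \<open>The sum is at most \<open>2 * exp (M / \<epsilon>)\<close>, and the factor 2 costs
  \<open>\<epsilon> * ln 2\<close>, which \<open>\<eta>\<close> absorbs.\<close>

lemma scaled_ext_ln_add_le:
  assumes "\<epsilon> > 0" "\<epsilon> * ln 2 \<le> \<eta>" "p \<ge> 0" "q \<ge> 0" "r \<ge> 0" "p \<le> q + r"
    and "ereal \<epsilon> * ext_ln q \<le> ereal M" "ereal \<epsilon> * ext_ln r \<le> ereal M"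
  shows "ereal \<epsilon> * ext_ln p \<le> ereal (M + \<eta>)"
proof -
  have "p \<le> 2 * exp (M / \<epsilon>)"
    using assms scaled_ext_ln_le_iff[of \<epsilon> q M] scaled_ext_ln_le_iff[of \<epsilon> r M] by linarith
  also have "\<dots> = exp (M / \<epsilon> + ln 2)" by (simp add: exp_add)
  also have "\<dots> \<le> exp ((M + \<eta>) / \<epsilon>)" using assms(1,2) by (simp add: field_simps)
  finally show ?thesis using scaled_ext_ln_le_iff assms by blast
qed

lemma eventually_scaled_ln_2_le:
  assumes "\<eta> > 0"
  shows "\<forall>\<^sub>F \<epsilon> in at_right 0. \<epsilon> * ln 2 \<le> (\<eta>::real)"
proof -
  have "((\<lambda>\<epsilon>. \<epsilon> * ln 2) \<longlongrightarrow> 0 * ln 2) (at_right (0::real))" by (intro tendsto_intros)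
  then have "\<forall>\<^sub>F \<epsilon> in at_right 0. \<epsilon> * ln 2 < \<eta>" using assms by (intro order_tendstoD) auto
  then show ?thesis by eventually_elim simp
qed

lemma eventually_in_unit_interval: "\<forall>\<^sub>F \<epsilon> in at_right 0. \<epsilon> \<in> {0<..<1::real}"
  by (rule eventually_at_rightI[of 0 1]) auto

text \<open>The upper bound need only be proved at real levels \<open>L\<close> strictly below the
  infimum \<open>a\<close>, which also covers infinite \<open>a\<close>. When \<open>a = 0\<close>
  no such level exists and the first assumption takes over.\<close>

lemma Limsup_le_uminus_enn2erealI:
  assumes "Limsup F f \<le> 0" "\<And>L. L \<ge> 0 \<Longrightarrow> ennreal L < a \<Longrightarrow> Limsup F f \<le> - ereal L"
  shows "Limsup F f \<le> - enn2ereal a"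
proof (rule ccontr)
  assume "\<not> ?thesis"
  then obtain M where M: "- enn2ereal a < ereal M" "ereal M < Limsup F f"
    using ereal_dense2 by (metis not_le)
  with assms(1) have M0: "M < 0" by (cases "Limsup F f") (auto simp: zero_ereal_def)
  have "ereal (- M) < enn2ereal a" using M(1) by (cases "enn2ereal a") auto
  then have "ennreal (- M) < a" using M0 by (simp add: less_ennreal.rep_eq)
  then have "Limsup F f \<le> - ereal (- M)" using M0 by (intro assms(2)) auto
  with M(2) show False by simp
qed

text \<open>On the exponential scale a sum of two terms is governed by the larger one.\<close>

lemma Limsup_scaled_ext_ln_le:
  assumes M: "Limsup (at_right 0) (\<lambda>\<epsilon>. ereal \<epsilon> * ext_ln (q \<epsilon>)) \<le> ereal M"
      "Limsup (at_right 0) (\<lambda>\<epsilon>. ereal \<epsilon> * ext_ln (r \<epsilon>)) \<le> ereal M"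
    and le: "\<forall>\<^sub>F \<epsilon> in at_right 0. p \<epsilon> \<le> q \<epsilon> + r \<epsilon>"
    and nonneg: "\<And>\<epsilon>. p \<epsilon> \<ge> 0" "\<And>\<epsilon>. q \<epsilon> \<ge> 0" "\<And>\<epsilon>. r \<epsilon> \<ge> 0"
  shows "Limsup (at_right 0) (\<lambda>\<epsilon>. ereal \<epsilon> * ext_ln (p \<epsilon>)) \<le> ereal M"
proof (rule ereal_le_epsilon2)
  fix \<eta> :: real assume \<eta>: "\<eta> > 0"
  have lt: "ereal M < ereal (M + \<eta> / 2)" using \<eta> by simp
  have "\<forall>\<^sub>F \<epsilon> in at_right 0. ereal \<epsilon> * ext_ln (q \<epsilon>) < ereal (M + \<eta> / 2)"
    "\<forall>\<^sub>F \<epsilon> in at_right 0. ereal \<epsilon> * ext_ln (r \<epsilon>) < ereal (M + \<eta> / 2)"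
    using le_less_trans[OF M(1) lt] le_less_trans[OF M(2) lt] by (auto intro: Limsup_lessD)
  then have "\<forall>\<^sub>F \<epsilon> in at_right 0. ereal \<epsilon> * ext_ln (p \<epsilon>) \<le> ereal (M + \<eta> / 2 + \<eta> / 2)"
    using le eventually_scaled_ln_2_le[OF half_gt_zero[OF \<eta>]] eventually_in_unit_interval
  proof eventually_elim
    case (elim \<epsilon>)
    show ?case
      using elim(5)
      by (intro scaled_ext_ln_add_le[OF _ elim(4) nonneg elim(3) less_imp_le[OF elim(1)] less_imp_le[OF elim(2)]]) auto
  qed
  then show "Limsup (at_right 0) (\<lambda>\<epsilon>. ereal \<epsilon> * ext_ln (p \<epsilon>)) \<le> ereal M + ereal \<eta>"
    by (intro Limsup_bounded) (simp add: add.commute)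
qed

text \<open>If \<open>r\<close> decays strictly faster than the lower bound for \<open>p\<close>, it
  cannot account for \<open>p\<close>, so \<open>q\<close> must inherit the bound.\<close>

lemma Liminf_scaled_ext_ln_ge:
  assumes p: "Liminf (at_right 0) (\<lambda>\<epsilon>. ereal \<epsilon> * ext_ln (p \<epsilon>)) \<ge> ereal M"
    and r: "Limsup (at_right 0) (\<lambda>\<epsilon>. ereal \<epsilon> * ext_ln (r \<epsilon>)) < ereal M"
    and le: "\<forall>\<^sub>F \<epsilon> in at_right 0. p \<epsilon> \<le> q \<epsilon> + r \<epsilon>"
    and nonneg: "\<And>\<epsilon>. p \<epsilon> \<ge> 0" "\<And>\<epsilon>. q \<epsilon> \<ge> 0" "\<And>\<epsilon>. r \<epsilon> \<ge> 0"
  shows "Liminf (at_right 0) (\<lambda>\<epsilon>. ereal \<epsilon> * ext_ln (q \<epsilon>)) \<ge> ereal M"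
proof (rule dense_le)
  fix y assume y: "y < ereal M"
  define f where "f = Limsup (at_right 0) (\<lambda>\<epsilon>. ereal \<epsilon> * ext_ln (r \<epsilon>))"
  have "max y f < ereal M" using y r by (simp add: f_def)
  then obtain a where a: "max y f < ereal a" "ereal a < ereal M" using ereal_dense2 by blast
  \<comment> \<open>Half the gap leaves \<open>a + \<eta>\<close> below \<open>M\<close>: were both
    \<open>q\<close> and \<open>r\<close> at scale at most \<open>a\<close>, then \<open>p\<close>
    would be at scale at most \<open>a + \<eta>\<close>, contradicting its lower bound.\<close>
  define \<eta> where "\<eta> = (M - a) / 2"
  have \<eta>: "\<eta> > 0" "a + \<eta> < M" using a(2) by (auto simp: \<eta>_def field_simps)
  have "\<forall>\<^sub>F \<epsilon> in at_right 0. ereal (a + \<eta>) < ereal \<epsilon> * ext_ln (p \<epsilon>)"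
    using p \<eta>(2) by (intro less_LiminfD) (auto intro: less_le_trans[rotated])
  moreover have "\<forall>\<^sub>F \<epsilon> in at_right 0. ereal \<epsilon> * ext_ln (r \<epsilon>) < ereal a"
    using a(1) by (intro Limsup_lessD) (simp add: f_def)
  ultimately have "\<forall>\<^sub>F \<epsilon> in at_right 0. y \<le> ereal \<epsilon> * ext_ln (q \<epsilon>)"
    using le eventually_scaled_ln_2_le[OF \<eta>(1)] eventually_in_unit_interval
  proof eventually_elim
    case (elim \<epsilon>)
    have "\<not> ereal \<epsilon> * ext_ln (q \<epsilon>) \<le> ereal a"
      using scaled_ext_ln_add_le[of \<epsilon> \<eta> "p \<epsilon>" "q \<epsilon>" "r \<epsilon>" a] elim nonneg by force
    with a(1) show ?case by (meson less_imp_le less_trans max_less_iff_conj not_le)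
  qed
  then show "y \<le> Liminf (at_right 0) (\<lambda>\<epsilon>. ereal \<epsilon> * ext_ln (q \<epsilon>))"
    by (rule Liminf_bounded)
qed

text \<open>Whenever \<open>X\<close> is in \<open>A\<close>, either \<open>Y\<close> is in
  \<open>B\<close> or the two variables are more than \<open>\<delta>\<close> apart.\<close>

lemma (in prob_space) measure_distr_le_dist:
  fixes X Y :: "'a \<Rightarrow> 'e::{metric_space, second_countable_topology}"
  assumes [measurable]: "X \<in> borel_measurable M" "Y \<in> borel_measurable M" "A \<in> sets borel" "B \<in> sets borel"
    and near: "\<And>x y. x \<in> A \<Longrightarrow> dist x y \<le> \<delta> \<Longrightarrow> y \<in> B"
  shows "measure (distr M borel X) A \<le>
    measure (distr M borel Y) B + measure M {\<omega> \<in> space M. dist (X \<omega>) (Y \<omega>) > \<delta>}"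
proof -
  let ?D = "{\<omega> \<in> space M. dist (X \<omega>) (Y \<omega>) > \<delta>}"
  have "measure M (X -` A \<inter> space M) \<le> measure M ((Y -` B \<inter> space M) \<union> ?D)"
    using near by (intro finite_measure_mono) (auto simp: not_less[symmetric])
  also have "\<dots> \<le> measure M (Y -` B \<inter> space M) + measure M ?D"
    by (intro measure_Un_le) auto
  finally show ?thesis by (simp add: measure_distr)
qed

lemma image_rate_le: "s \<in> effective_set I \<Longrightarrow> image_rate I G (G s) \<le> I s"
  unfolding image_rate_def by (rule INF_lower) simp

theorem theorem2p5:
  fixes I :: "'e::{banach, second_countable_topology} \<Rightarrow> ennreal"
    and N :: "'e \<Rightarrow> real"
    and F :: "nat \<Rightarrow> 'e \<Rightarrow> 'e" and F_lim :: "'e \<Rightarrow> 'e"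
    and P :: "'w measure"
    and X :: "nat \<Rightarrow> real \<Rightarrow> 'w \<Rightarrow> 'e" and X_lim :: "real \<Rightarrow> 'w \<Rightarrow> 'e"
  assumes good: "good_rate_function I"
    and dense: "closure (effective_set I) = UNIV"
    and hilbert: "hilbert_space_on (effective_set I) N"
    and level_weakly_compact:
      "\<And>L. L \<ge> 0 \<Longrightarrow> compactin (weak_topology (effective_set I) N) (level_set I L)"
    and level_bounded:
      "\<And>L. L \<ge> 0 \<Longrightarrow> \<exists>B. \<forall>s\<in>level_set I L. N s \<le> B"
    and level_closed:
      "\<And>L. L \<ge> 0 \<Longrightarrow> closedin (norm_topology (effective_set I) N) (level_set I L)"
    and embedding: "\<exists>C. \<forall>s\<in>effective_set I. norm s \<le> C * N s"
    and mapping: "\<And>n. n \<ge> 1 \<Longrightarrow> rate_function_mapping I N (F n)"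
    and uniform: "\<And>L. L \<ge> 0 \<Longrightarrow> uniform_limit (level_set I L) F F_lim sequentially"
    and prob: "prob_space P"
    and complete: "complete_measure P"
    and X_measurable:
      "\<And>n \<epsilon>. n \<ge> 1 \<Longrightarrow> \<epsilon> \<in> {0<..<1} \<Longrightarrow> X n \<epsilon> \<in> borel_measurable P"
    and X_lim_measurable: "\<And>\<epsilon>. \<epsilon> \<in> {0<..<1} \<Longrightarrow> X_lim \<epsilon> \<in> borel_measurable P"
    and exp_approx:
      "\<And>\<delta>. \<delta> > 0 \<Longrightarrow>
         ((\<lambda>n. Limsup (at_right 0) (\<lambda>\<epsilon>. ereal \<epsilon> *
            ext_ln (measure P {\<omega> \<in> space P. dist (X n \<epsilon> \<omega>) (X_lim \<epsilon> \<omega>) > \<delta>})))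
          \<longlongrightarrow> -\<infinity>) sequentially"
    and ldp:
      "\<And>n. n \<ge> 1 \<Longrightarrow>
         large_deviation_principle (\<lambda>\<epsilon>. distr P borel (X n \<epsilon>)) (image_rate I (F n))"
  shows "large_deviation_principle (\<lambda>\<epsilon>. distr P borel (X_lim \<epsilon>)) (image_rate I F_lim)"
proof -
  interpret prob_space P by (rule prob)
  define R where "R = (\<lambda>\<delta> n \<epsilon>. measure P {\<omega> \<in> space P. dist (X n \<epsilon> \<omega>) (X_lim \<epsilon> \<omega>) > \<delta>})"

  \<comment> \<open>Choice of the approximating index and compactness of the images of level
    sets\<close>
  have choose_n: "\<exists>n\<ge>1. Limsup (at_right 0) (\<lambda>\<epsilon>. ereal \<epsilon> * ext_ln (R \<delta> n \<epsilon>)) < ereal M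
      \<and> (\<forall>s\<in>level_set I L. dist (F n s) (F_lim s) < \<delta>)" if "\<delta> > 0" "L \<ge> 0" for \<delta> M L
  proof -
    have "\<forall>\<^sub>F n in sequentially. Limsup (at_right 0) (\<lambda>\<epsilon>. ereal \<epsilon> * ext_ln (R \<delta> n \<epsilon>)) < ereal M"
      using exp_approx[OF that(1)] unfolding R_def by (rule order_tendstoD) simp
    moreover have "\<forall>\<^sub>F n in sequentially. \<forall>s\<in>level_set I L. dist (F n s) (F_lim s) < \<delta>"
      using uniform_limitD[OF uniform[OF that(2)] that(1)] .
    ultimately have "\<forall>\<^sub>F n in sequentially. n \<ge> 1 \<and>
        Limsup (at_right 0) (\<lambda>\<epsilon>. ereal \<epsilon> * ext_ln (R \<delta> n \<epsilon>)) < ereal M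
        \<and> (\<forall>s\<in>level_set I L. dist (F n s) (F_lim s) < \<delta>)"
      using eventually_ge_at_top[of 1] by eventually_elim auto
    then show ?thesis using eventually_happens' sequentially_bot by fastforce
  qed
  have compact_image: "compact (F_lim ` level_set I L)" if L: "L \<ge> 0" for L
  proof -
    obtain C where C: "\<forall>s\<in>effective_set I. norm s \<le> C * N s" using embedding by blast
    have "continuous_on (level_set I L) (F n)" if "n \<ge> 1" for n
      using rate_function_mapping_continuous_on[OF C level_weakly_compact[OF L] L mapping[OF that]] .
    then have "\<forall>\<^sub>F n in sequentially. continuous_on (level_set I L) (F n)"
      by (rule eventually_sequentiallyI)
    then have "continuous_on (level_set I L) F_lim"
      using uniform[OF L] by (rule uniform_limit_theorem) simp
    then show ?thesis
      using good L by (intro compact_continuous_image) (auto simp: good_rate_function_def)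
  qed
  have in_level: "s \<in> effective_set I \<and> s \<in> level_set I L" if "I s \<le> ennreal L" for s L
    using that by (auto simp: level_set_def effective_set_def intro: le_less_trans)
  show ?thesis
    unfolding large_deviation_principle_def
  proof (intro conjI allI impI)

    \<comment> \<open>Upper bound for closed sets\<close>
    fix S :: "'e set" assume S: "closed S"
    let ?p = "\<lambda>\<epsilon>. measure (distr P borel (X_lim \<epsilon>)) S"
    show "Limsup (at_right 0) (\<lambda>\<epsilon>. ereal \<epsilon> * ext_ln (?p \<epsilon>)) \<le> - enn2ereal (INF s\<in>S. image_rate I F_lim s)"
    proof (rule Limsup_le_uminus_enn2erealI)
      \<comment> \<open>Probabilities are at most 1, which gives the bound 0 and settles the case of
        infimum 0.\<close>
      have "\<forall>\<^sub>F \<epsilon> in at_right 0. ereal \<epsilon> * ext_ln (?p \<epsilon>) \<le> ereal 0"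
        using eventually_in_unit_interval
      proof eventually_elim
        case (elim \<epsilon>)
        then have "prob_space (distr P borel (X_lim \<epsilon>))"
          using X_lim_measurable by (intro prob_space_distr)
        then have "?p \<epsilon> \<le> 1" by (rule prob_space.prob_le_1)
        with elim show ?case by (subst scaled_ext_ln_le_iff) auto
      qed
      then show "Limsup (at_right 0) (\<lambda>\<epsilon>. ereal \<epsilon> * ext_ln (?p \<epsilon>)) \<le> 0"
        by (intro Limsup_bounded) (simp add: zero_ereal_def)
    next
      fix L :: real assume L: "L \<ge> 0" "ennreal L < (INF s\<in>S. image_rate I F_lim s)"
      have "F_lim ` level_set I L \<inter> S = {}"
      proof (rule ccontr)
        assume "F_lim ` level_set I L \<inter> S \<noteq> {}"
        then obtain s where s: "I s \<le> ennreal L" "F_lim s \<in> S" by (auto simp: level_set_def)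
        have "(INF s\<in>S. image_rate I F_lim s) \<le> image_rate I F_lim (F_lim s)"
          using s(2) by (rule INF_lower)
        also have "\<dots> \<le> I s" using in_level[OF s(1)] by (intro image_rate_le) simp
        finally show False using s(1) L(2) by simp
      qed
      then have "F_lim ` level_set I L \<subseteq> - S" by blast
      then obtain d where d: "d > 0" "(\<Union>x\<in>F_lim ` level_set I L. ball x d) \<subseteq> - S"
        by (rule compact_subset_open_imp_ball_epsilon_subset[OF compact_image[OF L(1)] open_Compl[OF S]])
      \<comment> \<open>\<open>A\<close> excludes the points within \<open>2 * \<delta>\<close> of
        the compact image. A further move by \<open>\<delta>\<close> stays within \<open>d\<close>,
        so every point \<open>\<delta>\<close>-close to \<open>S\<close> is in
        \<open>A\<close>.\<close>
      define \<delta> where "\<delta> = d / 3"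
      have \<delta>: "\<delta> > 0" using d(1) by (simp add: \<delta>_def)
      define A where "A = - (\<Union>y\<in>F_lim ` level_set I L. ball y (2 * \<delta>))"
      have A: "closed A" unfolding A_def by auto
      obtain n where n: "n \<ge> 1" "Limsup (at_right 0) (\<lambda>\<epsilon>. ereal \<epsilon> * ext_ln (R \<delta> n \<epsilon>)) < ereal (- L)"
          "\<forall>s\<in>level_set I L. dist (F n s) (F_lim s) < \<delta>"
        using choose_n[OF \<delta> L(1)] by blast
      \<comment> \<open>A preimage of rate below \<open>L\<close> is in the level set, so its value
        under \<open>F n\<close> is within \<open>\<delta>\<close> of the compact image and thus
        outside \<open>A\<close>.\<close>
      have "ennreal L \<le> (INF z\<in>A. image_rate I (F n) z)"
      proof (rule INF_greatest, unfold image_rate_def, rule INF_greatest, rule ccontr)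
        fix z s assume z: "z \<in> A" and s: "s \<in> {s \<in> effective_set I. F n s = z}" "\<not> ennreal L \<le> I s"
        then have "s \<in> level_set I L" by (auto simp: level_set_def)
        then have "z \<in> ball (F_lim s) (2 * \<delta>)"
          using n(3) s(1) \<delta> by (force simp: dist_commute)
        with z \<open>s \<in> level_set I L\<close> show False by (auto simp: A_def)
      qed
      then have "ereal L \<le> enn2ereal (INF z\<in>A. image_rate I (F n) z)"
        using L(1) by (simp add: less_eq_ennreal.rep_eq)
      moreover have "Limsup (at_right 0) (\<lambda>\<epsilon>. ereal \<epsilon> * ext_ln (measure (distr P borel (X n \<epsilon>)) A))
          \<le> - enn2ereal (INF z\<in>A. image_rate I (F n) z)"
        using ldp[OF n(1)] A by (simp add: large_deviation_principle_def)
      ultimately have *: "Limsup (at_right 0) (\<lambda>\<epsilon>. ereal \<epsilon> * ext_ln (measure (distr P borel (X n \<epsilon>)) A))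
          \<le> ereal (- L)"
        by (subst uminus_ereal.simps(1)[symmetric]) (meson ereal_minus_le_minus order_trans)
      have near: "x \<in> A" if "y \<in> S" "dist y x \<le> \<delta>" for x y
      proof (rule ccontr)
        assume "x \<notin> A"
        then obtain z where z: "z \<in> F_lim ` level_set I L" "dist z x < 2 * \<delta>" by (auto simp: A_def)
        have "dist z y < d"
          using z(2) that(2) dist_triangle[of z y x] by (simp add: \<delta>_def dist_commute)
        with z(1) d(2) that(1) show False using mem_ball by blast
      qed
      have "\<forall>\<^sub>F \<epsilon> in at_right 0. ?p \<epsilon> \<le> measure (distr P borel (X n \<epsilon>)) A + R \<delta> n \<epsilon>"
        using eventually_in_unit_interval
      proof eventually_elim
        case (elim \<epsilon>)
        have "?p \<epsilon> \<le> measure (distr P borel (X n \<epsilon>)) A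
            + measure P {\<omega> \<in> space P. dist (X_lim \<epsilon> \<omega>) (X n \<epsilon> \<omega>) > \<delta>}"
          by (rule measure_distr_le_dist[OF X_lim_measurable[OF elim] X_measurable[OF n(1) elim]
            borel_closed[OF S] borel_closed[OF A] near])
        then show ?case by (simp add: R_def dist_commute)
      qed
      then show "Limsup (at_right 0) (\<lambda>\<epsilon>. ereal \<epsilon> * ext_ln (?p \<epsilon>)) \<le> - ereal L"
        using Limsup_scaled_ext_ln_le[OF * less_imp_le[OF n(2)]] by (simp add: R_def)
    qed
  next

    \<comment> \<open>Lower bound for open sets\<close>
    fix U :: "'e set" assume U: "open U"
    let ?q = "\<lambda>\<epsilon>. measure (distr P borel (X_lim \<epsilon>)) U"
    let ?l = "Liminf (at_right 0) (\<lambda>\<epsilon>. ereal \<epsilon> * ext_ln (?q \<epsilon>))"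
    have point: "- enn2ereal (I s) \<le> ?l" if s: "s \<in> effective_set I" "F_lim s \<in> U" for s
    proof -
      obtain L where L: "L \<ge> 0" "I s = ennreal L"
        using s(1) by (cases "I s") (auto simp: effective_set_def)
      obtain d where d: "d > 0" "ball (F_lim s) d \<subseteq> U" using U s(2) open_contains_ball by blast
      \<comment> \<open>One \<open>\<delta>\<close> is the radius of the ball in which
        \<open>X n\<close> is controlled, the other the allowed distance from \<open>X n\<close> to
        \<open>X_lim\<close>; together they stay within \<open>d\<close>.\<close>
      define \<delta> where "\<delta> = d / 2"
      have \<delta>: "\<delta> > 0" using d(1) by (simp add: \<delta>_def)
      let ?B = "ball (F_lim s) \<delta>"
      \<comment> \<open>The threshold \<open>- L\<close> makes the probability of a large deviation
        between the two variables negligible against the lower bound \<open>- L\<close> for the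
        ball.\<close>
      obtain n where n: "n \<ge> 1" "Limsup (at_right 0) (\<lambda>\<epsilon>. ereal \<epsilon> * ext_ln (R \<delta> n \<epsilon>)) < ereal (- L)"
          "\<forall>s\<in>level_set I L. dist (F n s) (F_lim s) < \<delta>"
        using choose_n[OF \<delta> L(1)] by blast
      have "F n s \<in> ?B" using n(3) L(2) by (auto simp: level_set_def dist_commute)
      then have "(INF z\<in>?B. image_rate I (F n) z) \<le> ennreal L"
        using image_rate_le[OF s(1), of "F n"] L(2) by (metis INF_lower2)
      then have "enn2ereal (INF z\<in>?B. image_rate I (F n) z) \<le> ereal L"
        using L(1) by (simp add: less_eq_ennreal.rep_eq)
      moreover have "- enn2ereal (INF z\<in>?B. image_rate I (F n) z)
          \<le> Liminf (at_right 0) (\<lambda>\<epsilon>. ereal \<epsilon> * ext_ln (measure (distr P borel (X n \<epsilon>)) ?B))"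
        using ldp[OF n(1)] by (simp add: large_deviation_principle_def)
      ultimately have *: "ereal (- L)
          \<le> Liminf (at_right 0) (\<lambda>\<epsilon>. ereal \<epsilon> * ext_ln (measure (distr P borel (X n \<epsilon>)) ?B))"
        by (subst uminus_ereal.simps(1)[symmetric]) (meson ereal_minus_le_minus order_trans)
      have near: "y \<in> U" if "x \<in> ?B" "dist x y \<le> \<delta>" for x y
        using that d(2) dist_triangle[of "F_lim s" y x] by (force simp: \<delta>_def)
      have "\<forall>\<^sub>F \<epsilon> in at_right 0. measure (distr P borel (X n \<epsilon>)) ?B \<le> ?q \<epsilon> + R \<delta> n \<epsilon>"
        using eventually_in_unit_interval
      proof eventually_elim
        case (elim \<epsilon>)
        show ?case
          unfolding R_def
          by (rule measure_distr_le_dist[OF X_measurable[OF n(1) elim] X_lim_measurable[OF elim]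
            borel_open[OF open_ball] borel_open[OF U] near])
      qed
      then have "ereal (- L) \<le> ?l"
        using Liminf_scaled_ext_ln_ge[OF * n(2)] by (simp add: R_def)
      then show ?thesis using L by simp
    qed
    \<comment> \<open>A smaller infimum would be undercut by a single \<open>s\<close> with
      \<open>F_lim s\<close> in \<open>U\<close>, against \<open>point\<close>. The passage to
      \<open>ennreal\<close> is faithful since failure of the bound forces \<open>- ?l\<close> to be
      nonnegative.\<close>
    have "- ?l \<le> enn2ereal (INF s\<in>U. image_rate I F_lim s)"
    proof (rule ccontr)
      assume "\<not> ?thesis"
      then have lt: "enn2ereal (INF s\<in>U. image_rate I F_lim s) < - ?l" by simp
      then have "(INF s\<in>U. image_rate I F_lim s) < e2ennreal (- ?l)"
        using order_trans[OF enn2ereal_nonneg less_imp_le[OF lt]]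
        by (simp add: less_ennreal.rep_eq enn2ereal_e2ennreal)
      then obtain s where s: "s \<in> effective_set I" "F_lim s \<in> U" "I s < e2ennreal (- ?l)"
        unfolding image_rate_def INF_less_iff by auto
      have "0 \<le> - ?l" using order_trans[OF enn2ereal_nonneg less_imp_le[OF lt]] .
      then have "enn2ereal (I s) < - ?l"
        using s(3) by (simp add: less_ennreal.rep_eq enn2ereal_e2ennreal)
      with point[OF s(1,2)] show False
        using ereal_uminus_le_reorder leD by blast
    qed
    then show "- enn2ereal (INF s\<in>U. image_rate I F_lim s) \<le> ?l"
      by (rule ereal_uminus_le_reorder[THEN iffD1])
  qed
qed

end
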